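(* Let $V$ be a Banach space and let $A$ be the infinitesimal generator of a $C_0$ group of bounded linear operators $T(t)$, $t\in\mathbb{R}$, on $V$. Let $P$ be a projection on $V$ and define the Green function $$G(t,s)=\begin{cases}T(t-s)P,& t\ge s,\\ -T(t-s)(I-P),& t\le s.\end{cases}$$ Assume that $A$ has an $\alpha$-exponential dichotomy, i.e., there exist two positive constants $c$ and $\alpha$ such that $\|G(t,s)\|\le ce^{-\alpha|t-s|}$ for all $(t,s)\in\mathbb{R}^2$. Then if $f\in AA(\mathbb{R},V)$, the equation $y'=Ay+f(t)$ has a unique solution $y\in AA(\mathbb{R},V)$, given by $$y(t)=\int_{\mathbb{R}}G(t,s)f(s)\,ds\quad\text{for all }t\in\mathbb{R},$$ and satisfying the estimate $$\|y\|_\infty\le\frac{2c}{\alpha}\|f\|_\infty.$$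
   Context: $AA(\mathbb{R},V)$ is the set of almost automorphic functions: continuous $\psi:\mathbb{R}\to V$ such that every real sequence has a subsequence $\{\tau_n\}$ for which $\tilde\psi(t)=\lim_n\psi(t+\tau_n)$ and $\psi(t)=\lim_n\tilde\psi(t-\tau_n)$ (pointwise) for all $t\in\mathbb{R}$. $\|\cdot\|_\infty$ is the sup norm over $\mathbb{R}$. The two-case definition of $G$ is printed as stated (the value on the diagonal $t=s$ is immaterial for the integral).
   Formalization: Uniqueness is asserted only when the projection P commutes with every T(t); without this the dichotomy bound does not imply uniqueness. "Solution" means mild (integrated) solution, since classical solutions need not exist for f merely almost automorphic. *)

theory Defs
  imports "HOL-Analysis.Analysis"
begin

definition c0_group :: "(real \<Rightarrow> 'a::banach \<Rightarrow>\<^sub>L 'a) \<Rightarrow> bool" where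
  "c0_group T \<longleftrightarrow>
     T 0 = id_blinfun \<and>
     (\<forall>s t. T (s + t) = T s o\<^sub>L T t) \<and>
     (\<forall>x. ((\<lambda>t. T t x) \<longlongrightarrow> x) (at 0))"

text \<open>
  An unbounded operator is a pair of its domain \<open>D\<close> and a function \<open>A\<close> whose values
  outside \<open>D\<close> are irrelevant. For a group the limit of the difference quotients at \<open>0\<close>
  is two-sided.
\<close>
definition infinitesimal_generator ::
    "'a::banach set \<Rightarrow> ('a \<Rightarrow> 'a) \<Rightarrow> (real \<Rightarrow> 'a \<Rightarrow>\<^sub>L 'a) \<Rightarrow> bool" where
  "infinitesimal_generator D A T \<longleftrightarrow>
     D = {x. \<exists>z. ((\<lambda>h. (T h x - x) /\<^sub>R h) \<longlongrightarrow> z) (at 0)} \<and>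
     (\<forall>x\<in>D. ((\<lambda>h. (T h x - x) /\<^sub>R h) \<longlongrightarrow> A x) (at 0))"

definition green :: "(real \<Rightarrow> 'a::banach \<Rightarrow>\<^sub>L 'a) \<Rightarrow> ('a \<Rightarrow>\<^sub>L 'a) \<Rightarrow> real \<Rightarrow> real \<Rightarrow> 'a \<Rightarrow>\<^sub>L 'a" where
  "green T P t s =
     (if s \<le> t then T (t - s) o\<^sub>L P else - (T (t - s) o\<^sub>L (id_blinfun - P)))"

definition almost_automorphic :: "(real \<Rightarrow> 'a::real_normed_vector) set" where
  "almost_automorphic = {\<psi>. continuous_on UNIV \<psi> \<and>
     (\<forall>\<sigma>::nat \<Rightarrow> real. \<exists>r \<phi>. strict_mono r \<and>
        (\<forall>t. (\<lambda>n. \<psi> (t + \<sigma> (r n))) \<longlonglongrightarrow> \<phi> t) \<and>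
        (\<forall>t. (\<lambda>n. \<phi> (t - \<sigma> (r n))) \<longlonglongrightarrow> \<psi> t))}"

text \<open>Meaningful for bounded functions only; almost automorphic functions are bounded.\<close>
definition sup_norm :: "(real \<Rightarrow> 'a::real_normed_vector) \<Rightarrow> real" where
  "sup_norm \<psi> = (SUP t. norm (\<psi> t))"

text \<open>
  For unbounded \<open>A\<close> and merely continuous \<open>f\<close>, solutions of \<open>y' = A y + f(t)\<close> are mild
  solutions: continuous functions satisfying the equation integrated over every interval.
  Differentiable solutions need not exist: let \<open>S\<close> be a unitary periodic group,
  \<open>T(t) = exp(-t) S(t)\<close> and \<open>f(t) = S(t) x\<close> with \<open>x\<close> outside the domain; then
  \<open>f\<close> itself is the only almost automorphic mild solution.
\<close>
definition mild_solution ::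
    "'a::banach set \<Rightarrow> ('a \<Rightarrow> 'a) \<Rightarrow> (real \<Rightarrow> 'a) \<Rightarrow> (real \<Rightarrow> 'a) \<Rightarrow> bool" where
  "mild_solution D A f y \<longleftrightarrow>
     continuous_on UNIV y \<and>
     (\<forall>s t. s \<le> t \<longrightarrow>
        integral {s..t} y \<in> D \<and>
        y t = y s + A (integral {s..t} y) + integral {s..t} f)"

text \<open>
  The dichotomy bound does not by itself force \<open>P\<close> to commute with the group, and without
  this uniqueness fails: for the right translations on \<open>L\<^sup>2(\<real>, exp(-2\<alpha>\<bar>x\<bar>) dx)\<close> and
  \<open>P\<close> the multiplication by the indicator function of \<open>[0, \<infinity>)\<close>, the bound holds with
  \<open>c = 1\<close>, but the constant function \<open>1\<close> is a fixed vector of the group, hence a nonzero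
  almost automorphic solution of \<open>y' = A y\<close>.
\<close>
definition commutes_with_group ::
    "('a::banach \<Rightarrow>\<^sub>L 'a) \<Rightarrow> (real \<Rightarrow> 'a \<Rightarrow>\<^sub>L 'a) \<Rightarrow> bool" where
  "commutes_with_group P T \<longleftrightarrow> (\<forall>t. T t o\<^sub>L P = P o\<^sub>L T t)"

end

theory Submission
  imports Defs
begin

text \<open>
  The solution is the convolution of \<open>f\<close> with the kernel \<open>K(u) = G(u, 0)\<close>,
  \<open>y(t) = \<integral> K(u) f(t - u) du\<close>. Hence \<open>\<parallel>y(a) - y(b)\<parallel>\<close> is at most
  \<open>\<integral> c exp(-\<alpha> \<bar>u\<bar>) \<parallel>f(a - u) - f(b - u)\<parallel> du\<close>, and dominated convergence carries
  the almost automorphy of \<open>f\<close> over to \<open>y\<close>. Splitting the integral shows that \<open>y\<close>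
  satisfies the variation of constants formula
  \<open>y(t + h) = T(h) y(t) + \<integral> T(t + h - s) f(s) ds\<close> over \<open>[t, t + h]\<close>; dividing by
  \<open>h\<close> after integration in \<open>t\<close> and letting \<open>h \<rightarrow> 0+\<close> identifies \<open>y\<close> as a mild solution.
  The difference \<open>w\<close> of two almost automorphic mild solutions is bounded and satisfies
  \<open>w(t) = T(t - s) w(s)\<close>. If \<open>P\<close> commutes with the group, the dichotomy makes
  \<open>P w(t) = T(t - s) P w(s)\<close> vanish as \<open>s \<rightarrow> -\<infinity>\<close>, and \<open>(I - P) w(t)\<close> as \<open>s \<rightarrow> \<infinity>\<close>.
\<close>

section \<open>Strongly continuous groups\<close>

lemma c0_group_zero: "c0_group T \<Longrightarrow> T 0 x = x"
  by (simp add: c0_group_def)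

lemma c0_group_add: "c0_group T \<Longrightarrow> T (s + t) x = T s (T t x)"
  by (simp add: c0_group_def)

lemma c0_group_minus: "c0_group T \<Longrightarrow> T t (T (- t) x) = x"
  by (metis add.right_inverse c0_group_add c0_group_zero)

lemma c0_group_continuous_orbit:
  assumes T: "c0_group T"
  shows "continuous_on UNIV (\<lambda>t. T t x)"
proof -
  have "((\<lambda>h. T (t + h) x) \<longlongrightarrow> T t x) (at 0)" for t
  proof -
    have "((\<lambda>h. T h x) \<longlongrightarrow> x) (at 0)"
      using T by (simp add: c0_group_def)
    then have "((\<lambda>h. T t (T h x)) \<longlongrightarrow> T t x) (at 0)"
      by (intro tendsto_intros)
    then show ?thesis
      by (simp add: c0_group_add[OF T])
  qed
  then show ?thesis
    by (simp add: continuous_on_eq_continuous_at isCont_iff)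
qed

text \<open>Baire category: the sets \<open>E n\<close> are closed by continuity of the orbits and
  cover the line. If all had empty interior, their complements would be open and dense with empty
  intersection. So some \<open>E n\<close> contains a ball around a point \<open>a\<close>, and
  composing with \<open>T (- a)\<close> moves that ball to 0.\<close>

lemma c0_group_locally_bounded:
  assumes T: "c0_group T"
  obtains \<delta> M where "\<delta> > 0" "\<And>h. \<bar>h\<bar> < \<delta> \<Longrightarrow> norm (T h) \<le> M"
proof -
  define E where "E n = {t. \<forall>x. norm (T t x) \<le> real n * norm x}" for n
  have closed: "closed (E n)" for n
    unfolding E_def
    by (intro closed_Collect_all closed_Collect_le continuous_on_norm
        c0_group_continuous_orbit[OF T] continuous_on_const)
  have cover: "\<exists>n. t \<in> E n" for t
  proof -
    obtain n where "norm (T t) \<le> real n"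
      using real_arch_simple by blast
    then have "norm (T t x) \<le> real n * norm x" for x
      by (rule order_trans[OF norm_blinfun mult_right_mono]) simp
    then have "t \<in> E n"
      by (simp add: E_def)
    then show ?thesis ..
  qed
  have "\<exists>n. interior (E n) \<noteq> {}"
  proof (rule ccontr)
    assume "\<not> ?thesis"
    then have dense: "closure (- E n) = UNIV" for n
      by (simp add: closure_complement)
    have "UNIV \<subseteq> closure (\<Inter>n. - E n)"
      by (rule Baire) (use closed dense in \<open>auto simp: open_Compl\<close>)
    moreover have "(\<Inter>n. - E n) = {}"
      using cover by auto
    ultimately show False
      by simp
  qed
  then obtain n a \<delta> where d: "\<delta> > 0" "ball a \<delta> \<subseteq> E n"
    by (meson all_not_in_conv mem_interior)
  have "norm (T h) \<le> real n * norm (T (- a))" if "\<bar>h\<bar> < \<delta>" for h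
  proof (rule norm_blinfun_bound)
    fix x
    have "a + h \<in> E n"
      using d that by (auto simp: dist_norm)
    then have "norm (T (a + h) (T (- a) x)) \<le> real n * norm (T (- a) x)"
      by (simp add: E_def)
    also have "\<dots> \<le> real n * (norm (T (- a)) * norm x)"
      by (intro mult_left_mono norm_blinfun) auto
    finally show "norm (T h x) \<le> real n * norm (T (- a)) * norm x"
      by (simp add: c0_group_add[OF T, symmetric] mult.assoc)
  qed auto
  with d show ?thesis
    using that by blast
qed

text \<open>Joint continuity of time and vector, although \<open>T\<close> is only strongly
  continuous. In the splitting \<open>T (\<tau> z) (g z - x) + T (\<tau> z) x\<close> the first term
  is controlled by local boundedness after factoring out \<open>T t\<close>, the second by
  continuity of the orbit of \<open>x\<close>.\<close>

lemma c0_group_tendsto: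
  assumes T: "c0_group T"
    and \<tau>: "(\<tau> \<longlongrightarrow> t) F" and g: "(g \<longlongrightarrow> x) F"
  shows "((\<lambda>z. T (\<tau> z) (g z)) \<longlongrightarrow> T t x) F"
proof -
  obtain \<delta> M where d: "\<delta> > 0" "\<And>h. \<bar>h\<bar> < \<delta> \<Longrightarrow> norm (T h) \<le> M"
    using c0_group_locally_bounded[OF T] by blast
  have "\<forall>\<^sub>F z in F. \<bar>\<tau> z - t\<bar> < \<delta>"
    using tendstoD[OF \<tau> d(1)] by (simp add: dist_norm)
  then have "\<forall>\<^sub>F z in F. norm (T (\<tau> z) (g z - x)) \<le> norm (T t) * (M * norm (g z - x))"
  proof eventually_elim
    case (elim z)
    have "T (\<tau> z) (g z - x) = T t (T (\<tau> z - t) (g z - x))"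
      by (simp add: c0_group_add[OF T, symmetric])
    also have "norm \<dots> \<le> norm (T t) * norm (T (\<tau> z - t) (g z - x))"
      by (rule norm_blinfun)
    also have "norm (T (\<tau> z - t) (g z - x)) \<le> M * norm (g z - x)"
      by (rule order_trans[OF norm_blinfun mult_right_mono[OF d(2)[OF elim]]]) simp
    finally show ?case
      by (simp add: mult_left_mono)
  qed
  moreover have "((\<lambda>z. norm (T t) * (M * norm (g z - x))) \<longlongrightarrow> 0) F"
    using g by (auto intro!: tendsto_eq_intros simp: LIM_zero)
  ultimately have "((\<lambda>z. T (\<tau> z) (g z - x)) \<longlongrightarrow> 0) F"
    by (rule Lim_null_comparison)
  moreover have "((\<lambda>z. T (\<tau> z) x) \<longlongrightarrow> T t x) F"
    by (rule continuous_on_tendsto_compose[OF c0_group_continuous_orbit[OF T] \<tau>]) simp_all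
  ultimately have "((\<lambda>z. T (\<tau> z) (g z - x) + T (\<tau> z) x) \<longlongrightarrow> 0 + T t x) F"
    by (rule tendsto_add)
  moreover have "T (\<tau> z) (g z - x) + T (\<tau> z) x = T (\<tau> z) (g z)" for z
    by (simp add: blinfun.diff_right)
  ultimately show ?thesis
    by simp
qed

lemma c0_group_continuous_on:
  assumes "c0_group T" "continuous_on S \<tau>" "continuous_on S g"
  shows "continuous_on S (\<lambda>z. T (\<tau> z) (g z))"
proof -
  have "((\<lambda>z. T (\<tau> z) (g z)) \<longlongrightarrow> T (\<tau> x) (g x)) (at x within S)" if "x \<in> S" for x
  proof (rule c0_group_tendsto[OF assms(1)])
    show "(\<tau> \<longlongrightarrow> \<tau> x) (at x within S)" "(g \<longlongrightarrow> g x) (at x within S)"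
      using assms(2,3) that by (simp_all add: continuous_on_def)
  qed
  then show ?thesis
    by (simp add: continuous_on_def)
qed

section \<open>The generator\<close>

lemma generatorD:
  assumes "infinitesimal_generator D A T" "x \<in> D"
  shows "((\<lambda>h. (T h x - x) /\<^sub>R h) \<longlongrightarrow> A x) (at 0)"
  using assms by (simp add: infinitesimal_generator_def)

lemma generatorI:
  assumes "infinitesimal_generator D A T" "((\<lambda>h. (T h x - x) /\<^sub>R h) \<longlongrightarrow> z) (at 0)"
  shows "x \<in> D" "A x = z"
proof -
  show "x \<in> D"
    using assms by (auto simp: infinitesimal_generator_def)
  from generatorD[OF assms(1) this] show "A x = z"
    using assms(2) by (metis at_neq_bot tendsto_unique)
qed

text \<open>Linearity of \<open>A\<close> on \<open>D\<close> is inherited from the difference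
  quotients. Only differences occur later, when two solutions are subtracted.\<close>

lemma generator_diff:
  assumes G: "infinitesimal_generator D A T" and "x \<in> D" "y \<in> D"
  shows "x - y \<in> D" "A (x - y) = A x - A y"
proof -
  have "((\<lambda>h. (T h x - x) /\<^sub>R h - (T h y - y) /\<^sub>R h) \<longlongrightarrow> A x - A y) (at 0)"
    by (intro tendsto_diff generatorD[OF G] assms)
  then have *: "((\<lambda>h. (T h (x - y) - (x - y)) /\<^sub>R h) \<longlongrightarrow> A x - A y) (at 0)"
    by (simp add: blinfun.diff_right algebra_simps)
  show "x - y \<in> D" "A (x - y) = A x - A y"
    using generatorI[OF G *] by auto
qed

section \<open>Almost automorphic functions\<close>

text \<open>An unbounded function would exceed \<open>n\<close> in norm at some
  \<open>\<sigma> n\<close>. Along the subsequence the values converge by the definition at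
  \<open>t = 0\<close>, hence are bounded, while \<open>r n \<ge> n\<close> makes them
  unbounded.\<close>

lemma almost_automorphic_bounded:
  assumes "f \<in> almost_automorphic"
  obtains B where "\<And>t. norm (f t) \<le> B"
proof -
  have "\<exists>B. \<forall>t. norm (f t) \<le> B"
  proof (rule ccontr)
    assume "\<not> ?thesis"
    then have "\<forall>n::nat. \<exists>t. norm (f t) > real n"
      by (meson not_le)
    then obtain \<sigma> where \<sigma>: "\<And>n::nat. norm (f (\<sigma> n)) > real n"
      by metis
    obtain r \<phi> where r: "strict_mono (r :: nat \<Rightarrow> nat)"
      and "\<forall>t. (\<lambda>n. f (t + \<sigma> (r n))) \<longlonglongrightarrow> \<phi> t"
      using assms by (force simp: almost_automorphic_def)
    then have "(\<lambda>n. f (0 + \<sigma> (r n))) \<longlonglongrightarrow> \<phi> 0"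
      by blast
    then have "Bseq (\<lambda>n. f (\<sigma> (r n)))"
      by (simp add: convergentI convergent_imp_Bseq)
    then obtain K where K: "\<And>n. norm (f (\<sigma> (r n))) \<le> K"
      by (auto simp: Bseq_def)
    obtain n where "K < real n"
      using reals_Archimedean2 by blast
    moreover have "real n \<le> real (r n)"
      using seq_suble[OF r] by simp
    ultimately show False
      using K[of n] \<sigma>[of "r n"] by linarith
  qed
  then show ?thesis
    using that by blast
qed

lemma weighted_integrable:
  fixes k w :: "real \<Rightarrow> real"
  assumes "continuous_on UNIV k" "k integrable_on UNIV" "\<And>u. 0 \<le> k u"
    and "continuous_on UNIV w" "\<And>u. \<bar>w u\<bar> \<le> C"
  shows "(\<lambda>u. k u * w u) integrable_on UNIV"
proof (rule integrable_on_all_intervals_integrable_bound)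
  show "(\<lambda>x. if x \<in> UNIV then k x * w x else 0) integrable_on cbox a b" for a b
    using assms by (auto intro!: integrable_continuous_real continuous_intros intro: continuous_on_subset)
  show "norm (k u * w u) \<le> k u * C" for u
    using assms by (auto simp: abs_mult intro!: mult_left_mono)
  show "(\<lambda>u. k u * C) integrable_on UNIV"
    using assms(2) by (rule integrable_on_mult_left)
qed

text \<open>Integrability of the limit belongs to the conclusion because the limits of translates of
  an almost automorphic function may be discontinuous.\<close>

lemma weighted_dominated_convergence:
  fixes k :: "real \<Rightarrow> real" and w :: "nat \<Rightarrow> real \<Rightarrow> real"
  assumes "k integrable_on UNIV" "\<And>u. 0 \<le> k u"
    and "\<And>n. (\<lambda>u. k u * w n u) integrable_on UNIV" "\<And>n u. \<bar>w n u\<bar> \<le> C"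
    and "\<And>u. (\<lambda>n. w n u) \<longlonglongrightarrow> v u"
  shows "(\<lambda>u. k u * v u) integrable_on UNIV"
    and "(\<lambda>n. integral UNIV (\<lambda>u. k u * w n u)) \<longlonglongrightarrow> integral UNIV (\<lambda>u. k u * v u)"
proof -
  have "(\<lambda>u. k u * C) integrable_on UNIV"
    using assms(1) by (rule integrable_on_mult_left)
  moreover have "norm (k u * w n u) \<le> k u * C" for n u
    using assms by (auto simp: abs_mult intro!: mult_left_mono)
  moreover have "(\<lambda>n. k u * w n u) \<longlonglongrightarrow> k u * v u" for u
    by (intro tendsto_intros assms)
  ultimately show "(\<lambda>u. k u * v u) integrable_on UNIV"
    and "(\<lambda>n. integral UNIV (\<lambda>u. k u * w n u)) \<longlonglongrightarrow> integral UNIV (\<lambda>u. k u * v u)"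
    using dominated_convergence[of "\<lambda>n u. k u * w n u" UNIV "\<lambda>u. k u * C" "\<lambda>u. k u * v u"] assms(3)
    by auto
qed

text \<open>
  The values of \<open>f\<close> enter only through a real integral, so that dominated convergence
  is needed for real functions only, although the target space need not be separable.
\<close>
lemma almost_automorphic_convolution:
  fixes f y :: "real \<Rightarrow> 'a::banach" and k :: "real \<Rightarrow> real"
  assumes f: "f \<in> almost_automorphic"
    and k: "continuous_on UNIV k" "k integrable_on UNIV" "\<And>u. 0 \<le> k u"
    and y: "\<And>a b. norm (y a - y b) \<le> integral UNIV (\<lambda>u. k u * norm (f (a - u) - f (b - u)))"
  shows "y \<in> almost_automorphic"
proof -
  have contf: "continuous_on UNIV f"
    using f by (simp add: almost_automorphic_def)
  then have contf': "continuous_on UNIV (\<lambda>u. f (a - u))" for a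
    by (rule continuous_on_compose2) (auto intro!: continuous_intros)
  obtain B where B: "\<And>t. norm (f t) \<le> B"
    using almost_automorphic_bounded[OF f] by blast
  have B2: "norm (v - w) \<le> 2 * B" if "norm v \<le> B" "norm w \<le> B" for v w :: 'a
    using norm_triangle_ineq4[of v w] that by linarith
  have int: "(\<lambda>u. k u * norm (f (a - u) - f (b - u))) integrable_on UNIV" for a b
    by (rule weighted_integrable[where C = "2 * B"])
      (use k B2 B contf' in \<open>auto intro!: continuous_intros\<close>)
  have cont: "continuous_on UNIV y"
    unfolding continuous_on_sequentially
  proof (intro ballI allI impI, elim conjE)
    fix x a assume x: "x \<longlonglongrightarrow> (a::real)"
    have "(\<lambda>n. integral UNIV (\<lambda>u. k u * norm (f (x n - u) - f (a - u))))
            \<longlonglongrightarrow> integral UNIV (\<lambda>u. k u * 0)"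
    proof (rule weighted_dominated_convergence(2)[where C = "2 * B"])
      fix u
      have "(\<lambda>n. f (x n - u)) \<longlonglongrightarrow> f (a - u)"
        by (rule continuous_on_tendsto_compose[OF contf]) (auto intro!: tendsto_intros x)
      then show "(\<lambda>n. norm (f (x n - u) - f (a - u))) \<longlonglongrightarrow> 0"
        by (simp add: tendsto_norm_zero LIM_zero)
    qed (use k int B2 B in auto)
    then have "(\<lambda>n. y (x n) - y a) \<longlonglongrightarrow> 0"
      by (intro Lim_null_comparison[OF always_eventually[OF allI[OF y]]]) simp
    then show "(y \<circ> x) \<longlonglongrightarrow> y a"
      by (simp add: LIM_zero_iff o_def)
  qed
  moreover have "\<exists>r \<phi>. strict_mono r \<and>
        (\<forall>t. (\<lambda>n. y (t + \<sigma> (r n))) \<longlonglongrightarrow> \<phi> t) \<and>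
        (\<forall>t. (\<lambda>n. \<phi> (t - \<sigma> (r n))) \<longlonglongrightarrow> y t)" for \<sigma> :: "nat \<Rightarrow> real"
  proof -
    obtain r \<phi> where r: "strict_mono (r :: nat \<Rightarrow> nat)"
      and f1: "\<And>t. (\<lambda>n. f (t + \<sigma> (r n))) \<longlonglongrightarrow> \<phi> t"
      and f2: "\<And>t. (\<lambda>n. \<phi> (t - \<sigma> (r n))) \<longlonglongrightarrow> f t"
      using f unfolding almost_automorphic_def by blast
    define \<rho> where "\<rho> = \<sigma> \<circ> r"
    have f1: "(\<lambda>n. f (t + \<rho> n)) \<longlonglongrightarrow> \<phi> t" and f2: "(\<lambda>n. \<phi> (t - \<rho> n)) \<longlonglongrightarrow> f t" for t
      using f1 f2 by (auto simp: \<rho>_def)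
    have \<phi>B: "norm (\<phi> t) \<le> B" for t
      by (rule Lim_norm_ubound[OF _ f1[of t]]) (auto simp: B)
    have shift: "(\<lambda>n. f (a + \<rho> n - u)) \<longlonglongrightarrow> \<phi> (a - u)" for a u
      using f1[of "a - u"] by (simp add: algebra_simps)
    have conv:
      "(\<lambda>u. k u * norm (\<phi> (a - u) - f (b - u))) integrable_on UNIV"
      "(\<lambda>n. integral UNIV (\<lambda>u. k u * norm (f (a + \<rho> n - u) - f (b - u))))
         \<longlonglongrightarrow> integral UNIV (\<lambda>u. k u * norm (\<phi> (a - u) - f (b - u)))" for a b
    proof -
      have "(\<lambda>n. norm (f (a + \<rho> n - u) - f (b - u))) \<longlonglongrightarrow> norm (\<phi> (a - u) - f (b - u))" for u
        by (intro tendsto_intros shift)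
      note * = weighted_dominated_convergence[OF k(2,3) int, where C = "2 * B", OF _ this]
      show "(\<lambda>u. k u * norm (\<phi> (a - u) - f (b - u))) integrable_on UNIV"
        and "(\<lambda>n. integral UNIV (\<lambda>u. k u * norm (f (a + \<rho> n - u) - f (b - u))))
         \<longlonglongrightarrow> integral UNIV (\<lambda>u. k u * norm (\<phi> (a - u) - f (b - u)))"
        using * B2 B by auto
    qed
    \<comment> \<open>\<open>e t n\<close> is the weighted distance between the limit function and
      the translate of \<open>f\<close> by \<open>\<rho> n\<close>; it controls how far
      \<open>y (t + \<rho> n)\<close> is from being Cauchy.\<close>
    define e where "e t n = integral UNIV (\<lambda>u. k u * norm (\<phi> (t - u) - f (t + \<rho> n - u)))" for t n
    have e: "e t \<longlonglongrightarrow> 0" for t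
    proof -
      have "(\<lambda>n. integral UNIV (\<lambda>u. k u * norm (\<phi> (t - u) - f (t + \<rho> n - u))))
            \<longlonglongrightarrow> integral UNIV (\<lambda>u. k u * 0)"
      proof (rule weighted_dominated_convergence(2)[where C = "2 * B"])
        show "(\<lambda>n. norm (\<phi> (t - u) - f (t + \<rho> n - u))) \<longlonglongrightarrow> 0" for u
          using tendsto_norm_zero[OF LIM_zero[OF shift[of t u]]] by (simp add: norm_minus_commute)
      qed (use k B2 B \<phi>B conv in auto)
      then show ?thesis
        by (simp add: e_def[abs_def])
    qed
    have ye: "norm (y (t + \<rho> m) - y (t + \<rho> n)) \<le> e t m + e t n" for t m n
    proof -
      have "norm (y (t + \<rho> m) - y (t + \<rho> n))
          \<le> integral UNIV (\<lambda>u. k u * norm (f (t + \<rho> m - u) - f (t + \<rho> n - u)))"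
        by (rule y)
      also have "\<dots> \<le> integral UNIV (\<lambda>u. k u * norm (\<phi> (t - u) - f (t + \<rho> m - u))
                                      + k u * norm (\<phi> (t - u) - f (t + \<rho> n - u)))"
      proof (intro integral_le integrable_add int conv)
        fix u
        have "norm (f (t + \<rho> m - u) - f (t + \<rho> n - u))
            \<le> norm (\<phi> (t - u) - f (t + \<rho> m - u)) + norm (\<phi> (t - u) - f (t + \<rho> n - u))"
          by (metis norm_minus_commute norm_diff_triangle_ineq norm_diff_triangle_le order_refl)
        then show "k u * norm (f (t + \<rho> m - u) - f (t + \<rho> n - u))
            \<le> k u * norm (\<phi> (t - u) - f (t + \<rho> m - u)) + k u * norm (\<phi> (t - u) - f (t + \<rho> n - u))"
          using k(3)[of u] by (simp add: distrib_left[symmetric] mult_left_mono)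
      qed
      also have "\<dots> = e t m + e t n"
        unfolding e_def by (intro integral_add conv)
      finally show ?thesis .
    qed
    \<comment> \<open>The limit of the translates of \<open>y\<close> comes from completeness of the
      space, so no vector-valued integral of \<phi> has to be formed.\<close>
    have "Cauchy (\<lambda>n. y (t + \<rho> n))" for t
    proof (rule CauchyI)
      fix \<epsilon> :: real assume "\<epsilon> > 0"
      then have "\<forall>\<^sub>F n in sequentially. e t n < \<epsilon> / 2"
        using order_tendstoD(2)[OF e, of "\<epsilon> / 2"] by simp
      then obtain N where "\<And>n. n \<ge> N \<Longrightarrow> e t n < \<epsilon> / 2"
        by (auto simp: eventually_sequentially)
      then have "norm (y (t + \<rho> m) - y (t + \<rho> n)) < \<epsilon>" if "m \<ge> N" "n \<ge> N" for m n
        using ye[of t m n] that by (smt (verit) field_sum_of_halves)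
      then show "\<exists>N. \<forall>m\<ge>N. \<forall>n\<ge>N. norm (y (t + \<rho> m) - y (t + \<rho> n)) < \<epsilon>"
        by blast
    qed
    then have \<eta>: "(\<lambda>n. y (t + \<rho> n)) \<longlonglongrightarrow> lim (\<lambda>n. y (t + \<rho> n))" for t
      using Cauchy_convergent convergent_LIMSEQ_iff by blast
    define \<eta> where "\<eta> t = lim (\<lambda>n. y (t + \<rho> n))" for t
    note \<eta> = \<eta>[folded \<eta>_def]
    \<comment> \<open>Letting \<open>n\<close> tend to infinity in the estimate for
      \<open>y (a + \<rho> n) - y b\<close> carries it over to \<eta>. The choice
      \<open>a = t - \<rho> n\<close>, \<open>b = t\<close> then yields the return limit.\<close>
    have \<eta>y: "norm (\<eta> a - y b) \<le> integral UNIV (\<lambda>u. k u * norm (\<phi> (a - u) - f (b - u)))" for a b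
    proof (rule LIMSEQ_le[OF _ conv(2)])
      show "(\<lambda>n. norm (y (a + \<rho> n) - y b)) \<longlonglongrightarrow> norm (\<eta> a - y b)"
        by (intro tendsto_intros \<eta>)
    qed (use y in simp)
    have "(\<lambda>n. \<eta> (t - \<rho> n)) \<longlonglongrightarrow> y t" for t
    proof -
      have "(\<lambda>n. integral UNIV (\<lambda>u. k u * norm (\<phi> (t - \<rho> n - u) - f (t - u))))
            \<longlonglongrightarrow> integral UNIV (\<lambda>u. k u * 0)"
      proof (rule weighted_dominated_convergence(2)[where C = "2 * B"])
        fix u
        have "(\<lambda>n. \<phi> (t - \<rho> n - u)) \<longlonglongrightarrow> f (t - u)"
          using f2[of "t - u"] by (simp add: algebra_simps)
        then show "(\<lambda>n. norm (\<phi> (t - \<rho> n - u) - f (t - u))) \<longlonglongrightarrow> 0"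
          by (simp add: tendsto_norm_zero LIM_zero)
      qed (use k conv B2 B \<phi>B in auto)
      then have "(\<lambda>n. \<eta> (t - \<rho> n) - y t) \<longlonglongrightarrow> 0"
        by (intro Lim_null_comparison[OF always_eventually[OF allI[OF \<eta>y]]]) simp
      then show ?thesis
        by (simp add: LIM_zero_iff)
    qed
    with r \<eta> show ?thesis
      by (intro exI[of _ r] exI[of _ \<eta>]) (auto simp: \<rho>_def)
  qed
  ultimately show ?thesis
    by (simp add: almost_automorphic_def)
qed

section \<open>Integrals on the real line\<close>

text \<open>The integral over the line is tested on large intervals, and \<open>u\<close> to
  \<open>t - u\<close> maps \<open>{a..b}\<close> onto \<open>{t - b..t - a}\<close>. Enlarging the
  radius \<open>B\<close> by \<open>\<bar>t\<bar>\<close> guarantees that the image still contains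
  the ball of radius \<open>B\<close>.\<close>

lemma has_integral_reflect_translate:
  fixes g :: "real \<Rightarrow> 'a::banach"
  assumes g: "(g has_integral I) UNIV"
  shows "((\<lambda>u. g (t - u)) has_integral I) UNIV"
proof -
  have g': "\<And>a b. g integrable_on {a..b}"
    "\<And>e. e > 0 \<Longrightarrow> \<exists>B>0. \<forall>a b. ball 0 B \<subseteq> {a..b} \<longrightarrow> norm (integral {a..b} g - I) < e"
    using g unfolding has_integral_alt'[of g I UNIV] by auto
  have *: "((\<lambda>u. g (t - u)) has_integral integral {t - b..t - a} g) {a..b}" for a b
    using has_integral_affinity[OF integrable_integral[OF g'(1)[of "t - b" "t - a", folded cbox_interval]], of "-1" t]
    by (simp add: image_diff_atLeastAtMost)
  show ?thesis
    unfolding has_integral_alt'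
  proof (intro conjI allI impI)
    show "(\<lambda>x. if x \<in> UNIV then g (t - x) else 0) integrable_on cbox a b" for a b
      using * by auto
  next
    fix e :: real assume "e > 0"
    then obtain B where B: "B > 0"
      "\<And>a b. ball 0 B \<subseteq> {a..b} \<Longrightarrow> norm (integral {a..b} g - I) < e"
      using g'(2) by blast
    have "norm (integral {a..b} (\<lambda>u. g (t - u)) - I) < e" if "ball 0 (B + \<bar>t\<bar>) \<subseteq> {a..b}" for a b
    proof -
      have "x \<in> {t - b..t - a}" if "x \<in> ball 0 B" for x
      proof -
        have "t - x \<in> ball 0 (B + \<bar>t\<bar>)"
          using that by auto
        then have "t - x \<in> {a..b}"
          using \<open>ball 0 (B + \<bar>t\<bar>) \<subseteq> {a..b}\<close> by blast
        then show ?thesis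
          by auto
      qed
      then have "norm (integral {t - b..t - a} g - I) < e"
        by (intro B) blast
      then show ?thesis
        by (simp add: integral_unique[OF *])
    qed
    then show "\<exists>B>0. \<forall>a b. ball 0 B \<subseteq> cbox a b \<longrightarrow>
        norm (integral (cbox a b) (\<lambda>x. if x \<in> UNIV then g (t - x) else 0) - I) < e"
      using B(1) by (intro exI[of _ "B + \<bar>t\<bar>"]) auto
  qed
qed

text \<open>The two-sided exponential is the one-sided one plus its reflection, except at 0, where
  both contribute. The value is the constant of the final estimate.\<close>

lemma has_integral_exp_abs:
  assumes "\<alpha> > (0::real)"
  shows "((\<lambda>u. c * exp (- \<alpha> * \<bar>u\<bar>)) has_integral 2 * c / \<alpha>) UNIV"
proof -
  define g where "g u = (if u \<in> {0..} then exp (- \<alpha> * u) else 0)" for u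
  have g: "(g has_integral 1 / \<alpha>) UNIV"
    using has_integral_exp_minus_to_infinity[OF assms, of 0]
    unfolding g_def has_integral_restrict_UNIV by simp
  have "((\<lambda>u. g u + g (0 - u)) has_integral 1 / \<alpha> + 1 / \<alpha>) UNIV"
    by (intro has_integral_add g has_integral_reflect_translate)
  then have "((\<lambda>u. exp (- \<alpha> * \<bar>u\<bar>)) has_integral 1 / \<alpha> + 1 / \<alpha>) UNIV"
    by (rule has_integral_spike_finite[of "{0}", rotated 2]) (auto simp: g_def)
  from has_integral_mult_right[OF this, of c] show ?thesis
    by (simp add: algebra_simps)
qed

text \<open>Replaces an interval that shrinks with \<open>h\<close> by a fixed one, so that limits
  as \<open>h\<close> tends to 0 become continuity of integrals in a parameter.\<close>

lemma integral_rescale: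
  fixes g :: "real \<Rightarrow> 'a::banach"
  assumes "continuous_on {r..r + h} g" "h \<ge> 0"
  shows "integral {r..r + h} g = h *\<^sub>R integral {0..1} (\<lambda>\<theta>. g (r + h * \<theta>))"
proof (cases "h = 0")
  case False
  then have h: "h > 0"
    using assms by simp
  have "(g has_integral integral {r..r + h} g) (cbox r (r + h))"
    using assms by (simp add: integrable_integral integrable_continuous_real)
  from has_integral_affinity'[OF this h, of r]
  have "((\<lambda>\<theta>. g (r + h * \<theta>)) has_integral integral {r..r + h} g /\<^sub>R h) {0..1}"
    using h by (simp add: add.commute)
  then show ?thesis
    using h by (simp add: integral_unique)
qed auto

lemma integral_mean_tendsto:
  fixes y :: "real \<Rightarrow> 'a::banach"
  assumes "continuous_on UNIV y"
  shows "((\<lambda>h. integral {0..1} (\<lambda>\<theta>. y (t + h * \<theta>))) \<longlongrightarrow> y t) (at_right 0)"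
proof -
  have "continuous_on UNIV (\<lambda>h. integral (cbox 0 1) (\<lambda>\<theta>. y (t + h * \<theta>)))"
    by (intro integral_continuous_on_param)
      (auto simp: case_prod_unfold intro!: continuous_on_compose2[OF assms] continuous_intros)
  then have "((\<lambda>h. integral (cbox 0 1) (\<lambda>\<theta>. y (t + h * \<theta>))) \<longlongrightarrow> integral (cbox 0 1) (\<lambda>\<theta>. y (t + 0 * \<theta>))) (at 0)"
    unfolding continuous_on_def by blast
  then show ?thesis
    by (simp add: filterlim_at_split)
qed

section \<open>Variation of constants\<close>

text \<open>The difference quotient at \<open>- h\<close> is \<open>T (- h)\<close> applied to the
  quotient at \<open>h\<close>, so by joint continuity the left limit exists and agrees with the
  right one.\<close>

lemma generator_right:
  assumes T: "c0_group T"
    and lim: "((\<lambda>h. (T h x - x) /\<^sub>R h) \<longlongrightarrow> z) (at_right 0)"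
  shows "((\<lambda>h. (T h x - x) /\<^sub>R h) \<longlongrightarrow> z) (at 0)"
proof -
  have "((\<lambda>h. T (- h) ((T h x - x) /\<^sub>R h)) \<longlongrightarrow> T (- 0) z) (at_right 0)"
    by (rule c0_group_tendsto[OF T _ lim]) (rule tendsto_minus[OF tendsto_ident_at])
  moreover have "T (- h) ((T h x - x) /\<^sub>R h) = (T (- h) x - x) /\<^sub>R (- h)" for h
    using c0_group_minus[OF T, of "- h" x]
    by (simp add: blinfun.diff_right blinfun.scaleR_right scaleR_diff_right)
  ultimately show ?thesis
    using lim by (simp add: filterlim_at_split filterlim_at_left_to_right c0_group_zero[OF T])
qed

text \<open>The formula expresses \<open>T h (y r)\<close> through \<open>y (r + h)\<close>.
  Integrating in \<open>r\<close> turns the difference quotient at the integral of \<open>y\<close>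
  into two boundary means of \<open>y\<close> minus an average of \<open>f\<close>, and each of them
  converges.\<close>

lemma mild_solution_variation_of_constants:
  fixes T :: "real \<Rightarrow> 'a::banach \<Rightarrow>\<^sub>L 'a"
  assumes T: "c0_group T" and G: "infinitesimal_generator D A T"
    and f: "continuous_on UNIV f" and y: "continuous_on UNIV y"
    and voc: "\<And>t h. h \<ge> 0 \<Longrightarrow> y (t + h) = T h (y t) + integral {t..t + h} (\<lambda>s. T (t + h - s) (f s))"
  shows "mild_solution D A f y"
proof -
  \<comment> \<open>\<open>J h r\<close> is the integral in the formula divided by \<open>h\<close>,
    rescaled to \<open>{0..1}\<close>. In this form it also makes sense at \<open>h = 0\<close>,
    where it equals \<open>f r\<close>.\<close>
  define J where "J h r = integral {0..1} (\<lambda>\<theta>. T (h * (1 - \<theta>)) (f (r + h * \<theta>)))" for h r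
  have contJ: "continuous_on UNIV (\<lambda>(h, r). J h r)"
  proof -
    have "continuous_on (UNIV \<times> cbox 0 1)
        (\<lambda>p. T (fst (fst p) * (1 - snd p)) (f (snd (fst p) + fst (fst p) * snd p)))"
      by (rule c0_group_continuous_on[OF T])
        (auto intro!: continuous_on_compose2[OF f] continuous_intros)
    then show ?thesis
      unfolding J_def case_prod_unfold cbox_interval[symmetric]
      by (intro integral_continuous_on_param) (simp add: case_prod_unfold)
  qed
  have yJ: "T h (y r) = y (r + h) - h *\<^sub>R J h r" if "h \<ge> 0" for h r
  proof -
    have "integral {r..r + h} (\<lambda>s. T (r + h - s) (f s))
        = h *\<^sub>R integral {0..1} (\<lambda>\<theta>. T (r + h - (r + h * \<theta>)) (f (r + h * \<theta>)))"
      using that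
      by (intro integral_rescale c0_group_continuous_on[OF T] continuous_on_subset[OF f] continuous_intros) auto
    then show ?thesis
      using voc[OF that, of r] by (simp add: J_def algebra_simps)
  qed
  have inty: "y integrable_on {a..b}" for a b
    by (intro integrable_continuous_real continuous_on_subset[OF y]) auto
  have main: "((\<lambda>h. (T h (integral {s..t} y) - integral {s..t} y) /\<^sub>R h)
      \<longlongrightarrow> y t - y s - integral {s..t} f) (at 0)" if "s \<le> t" for s t
  proof (rule generator_right[OF T])
    have quot: "(T h (integral {s..t} y) - integral {s..t} y) /\<^sub>R h
      = integral {0..1} (\<lambda>\<theta>. y (t + h * \<theta>)) - integral {0..1} (\<lambda>\<theta>. y (s + h * \<theta>))
          - integral {s..t} (J h)" if "h > 0" for h
    proof -
      have contJh: "continuous_on {s..t} (J h)"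
        using continuous_on_compose2[OF contJ, of "{s..t}" "\<lambda>r. (h, r)"]
        by (simp add: continuous_on_Pair)
      have yh: "continuous_on {s..t} (\<lambda>r. y (r + h))"
        by (intro continuous_on_compose2[OF y] continuous_intros) auto
      have "T h (integral {s..t} y) = integral {s..t} (\<lambda>r. T h (y r))"
        using integral_linear[OF inty blinfun.bounded_linear_right, of s t "T h"] by (simp add: o_def)
      also have "\<dots> = integral {s..t} (\<lambda>r. y (r + h)) - h *\<^sub>R integral {s..t} (J h)"
        using that contJh yh
        by (simp add: yJ integral_diff integrable_continuous_real continuous_on_scaleR continuous_on_const)
      also have "integral {s..t} (\<lambda>r. y (r + h)) = integral {s + h..t + h} y"
        using integral_shift_Icc_real[of s t y h] by (simp add: o_def add.commute)
      \<comment> \<open>Shifting by \<open>h\<close> changes the integral only by two pieces of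
        length \<open>h\<close> at the ends; after division by \<open>h\<close> they become the
        means near \<open>t\<close> and \<open>s\<close>.\<close>
      also have "\<dots> = integral {s..t} y + integral {t..t + h} y - integral {s..s + h} y"
        using Henstock_Kurzweil_Integration.integral_combine[OF _ _ inty, of s t "t + h"]
          Henstock_Kurzweil_Integration.integral_combine[OF _ _ inty, of s "s + h" "t + h"]
          \<open>s \<le> t\<close> \<open>h > 0\<close> by (simp add: algebra_simps)
      also have "integral {t..t + h} y = h *\<^sub>R integral {0..1} (\<lambda>\<theta>. y (t + h * \<theta>))"
        using that by (intro integral_rescale continuous_on_subset[OF y]) auto
      also have "integral {s..s + h} y = h *\<^sub>R integral {0..1} (\<lambda>\<theta>. y (s + h * \<theta>))"
        using that by (intro integral_rescale continuous_on_subset[OF y]) auto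
      finally show ?thesis
        using that by (simp add: scaleR_diff_right scaleR_add_right)
    qed
    have "continuous_on UNIV (\<lambda>h. integral (cbox s t) (J h))"
      using contJ by (intro integral_continuous_on_param) (auto intro: continuous_on_subset)
    then have "((\<lambda>h. integral {s..t} (J h)) \<longlongrightarrow> integral {s..t} (J 0)) (at_right 0)"
      by (simp add: continuous_on_def filterlim_at_split)
    moreover have "J 0 = f"
      by (simp add: J_def c0_group_zero[OF T] fun_eq_iff)
    ultimately have "((\<lambda>h. integral {0..1} (\<lambda>\<theta>. y (t + h * \<theta>)) - integral {0..1} (\<lambda>\<theta>. y (s + h * \<theta>))
          - integral {s..t} (J h)) \<longlongrightarrow> y t - y s - integral {s..t} f) (at_right 0)"
      by (intro tendsto_diff integral_mean_tendsto y) simp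
    then show "((\<lambda>h. (T h (integral {s..t} y) - integral {s..t} y) /\<^sub>R h)
      \<longlongrightarrow> y t - y s - integral {s..t} f) (at_right 0)"
      by (rule Lim_transform_eventually) (auto simp: quot eventually_at_right_less eventually_at_topological)
  qed
  show ?thesis
    unfolding mild_solution_def
    using y generatorI[OF G main] by (auto simp: algebra_simps)
qed

section \<open>The homogeneous equation\<close>

lemma has_vector_derivative_iff_quotient:
  "(f has_vector_derivative d) (at x within S) \<longleftrightarrow>
     ((\<lambda>y. (f y - f x) /\<^sub>R (y - x)) \<longlongrightarrow> d) (at x within S)"
proof -
  have "norm (f y - f x - (y - x) *\<^sub>R d) / norm (y - x) = norm ((f y - f x) /\<^sub>R (y - x) - d)"
    if "y \<noteq> x" for y
  proof -
    have "(f y - f x) /\<^sub>R (y - x) - d = (f y - f x - (y - x) *\<^sub>R d) /\<^sub>R (y - x)"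
      using that by (simp add: scaleR_diff_right)
    then show ?thesis
      by (simp add: divide_inverse_commute)
  qed
  then have "\<forall>\<^sub>F y in at x within S.
      norm (f y - f x - (y - x) *\<^sub>R d) / norm (y - x) = norm ((f y - f x) /\<^sub>R (y - x) - d)"
    by (auto simp: eventually_at_topological)
  from tendsto_cong[OF this, of 0] show ?thesis
    by (simp add: has_vector_derivative_def has_derivative_iff_norm bounded_linear_scaleR_left
        tendsto_norm_zero_iff LIM_zero_iff)
qed

text \<open>Serves twice: to compare a homogeneous solution with an orbit, and to reduce uniqueness
  to the homogeneous equation.\<close>

lemma mild_solution_diff:
  assumes G: "infinitesimal_generator D A T"
    and f: "continuous_on UNIV f" and g: "continuous_on UNIV g"
    and y: "mild_solution D A f y" and z: "mild_solution D A g z"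
  shows "mild_solution D A (\<lambda>t. f t - g t) (\<lambda>t. y t - z t)"
proof -
  have cont: "continuous_on UNIV y" "continuous_on UNIV z"
    using y z by (auto simp: mild_solution_def)
  have int: "integral {s..t} (\<lambda>t. y t - z t) = integral {s..t} y - integral {s..t} z"
    "integral {s..t} (\<lambda>t. f t - g t) = integral {s..t} f - integral {s..t} g" for s t
    by (intro integral_diff integrable_continuous_real continuous_on_subset[OF f]
        continuous_on_subset[OF g] continuous_on_subset[OF cont(1)] continuous_on_subset[OF cont(2)]; simp)+
  have "y t - z t = y s - z s + A (integral {s..t} (\<lambda>t. y t - z t)) + integral {s..t} (\<lambda>t. f t - g t)
      \<and> integral {s..t} (\<lambda>t. y t - z t) \<in> D" if "s \<le> t" for s t
  proof -
    have D: "integral {s..t} y \<in> D" "integral {s..t} z \<in> D"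
      and *: "y t = y s + A (integral {s..t} y) + integral {s..t} f"
        "z t = z s + A (integral {s..t} z) + integral {s..t} g"
      using y z that by (auto simp: mild_solution_def)
    show ?thesis
      using generator_diff[OF G D] by (simp add: int) (simp add: *)
  qed
  then show ?thesis
    using cont by (auto simp: mild_solution_def intro: continuous_on_diff)
qed

text \<open>The primitive \<open>U\<close> takes values in \<open>D\<close> and is a classical
  solution of \<open>U' = A U\<close> with \<open>U s = 0\<close>. Hence
  \<open>T (t - r) (U r)\<close> has derivative zero in \<open>r\<close>; comparing
  \<open>r = s\<close> with \<open>r = t\<close> gives \<open>U t = 0\<close>, and
  \<open>u t = A (U t)\<close>.\<close>

lemma homogeneous_mild_solution_zero:
  assumes T: "c0_group T" and G: "infinitesimal_generator D A T"
    and u: "mild_solution D A (\<lambda>t. 0) u" and "u s = 0" "s \<le> t"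
  shows "u t = 0"
proof -
  define U where "U r = integral {s..r} u" for r
  have contu: "continuous_on {s..t} u"
    using u by (auto simp: mild_solution_def intro: continuous_on_subset)
  have U: "U r \<in> D" "u r = A (U r)" if "s \<le> r" for r
    using u that \<open>u s = 0\<close> unfolding mild_solution_def U_def by auto
  have "((\<lambda>r. T (t - r) (U r)) has_vector_derivative 0) (at r within {s..t})" if r: "r \<in> {s..t}" for r
    unfolding has_vector_derivative_iff_quotient
  proof -
    have "((\<lambda>q. (U q - U r) /\<^sub>R (q - r)) \<longlongrightarrow> u r) (at r within {s..t})"
      using integral_has_vector_derivative[OF contu r]
      by (simp add: has_vector_derivative_iff_quotient U_def)
    then have "((\<lambda>q. T (t - q) ((U q - U r) /\<^sub>R (q - r))) \<longlongrightarrow> T (t - r) (u r)) (at r within {s..t})"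
      by (intro c0_group_tendsto[OF T]) (auto intro!: tendsto_intros)
    \<comment> \<open>The second half of the product rule: \<open>T (t - q) (U r)\<close> factors as
      \<open>T (t - r) (T (r - q) (U r))\<close>, and \<open>U r\<close> lies in the domain of the
      generator.\<close>
    moreover have "((\<lambda>q. T (t - r) ((T (r - q) (U r) - U r) /\<^sub>R (r - q))) \<longlongrightarrow> T (t - r) (A (U r)))
        (at r within {s..t})"
    proof -
      have "filterlim (\<lambda>q. r - q) (at 0) (at r within {s..t})"
        unfolding filterlim_at by (auto simp: eventually_at_topological intro!: tendsto_eq_intros)
      from filterlim_compose[OF generatorD[OF G U(1)] this] r show ?thesis
        by (intro tendsto_intros) auto
    qed
    ultimately have "((\<lambda>q. T (t - q) ((U q - U r) /\<^sub>R (q - r))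
          - T (t - r) ((T (r - q) (U r) - U r) /\<^sub>R (r - q))) \<longlongrightarrow> T (t - r) (u r) - T (t - r) (A (U r)))
        (at r within {s..t})"
      by (rule tendsto_diff)
    \<comment> \<open>Also true for \<open>q = r\<close>, where every term vanishes because the
      inverse of 0 is 0.\<close>
    moreover have "T (t - q) ((U q - U r) /\<^sub>R (q - r)) - T (t - r) ((T (r - q) (U r) - U r) /\<^sub>R (r - q))
        = (T (t - q) (U q) - T (t - r) (U r)) /\<^sub>R (q - r)" for q
    proof -
      have "inverse (r - q) = - inverse (q - r)"
        by (metis inverse_minus_eq minus_diff_eq)
      then show ?thesis
        by (simp add: blinfun.diff_right blinfun.scaleR_right c0_group_add[OF T, symmetric] algebra_simps)
    qed
    ultimately show "((\<lambda>q. (T (t - q) (U q) - T (t - r) (U r)) /\<^sub>R (q - r)) \<longlongrightarrow> 0) (at r within {s..t})"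
      using U(2) r by simp
  qed
  then obtain c where c: "\<And>r. r \<in> {s..t} \<Longrightarrow> T (t - r) (U r) = c"
    using has_vector_derivative_zero_constant[of "{s..t}"] by blast
  have "U t = 0"
    using c[of s] c[of t] \<open>s \<le> t\<close> by (simp add: c0_group_zero[OF T]) (simp add: U_def)
  moreover have "A 0 = 0"
    using generator_diff(2)[OF G U(1) U(1), of s s] by simp
  ultimately show ?thesis
    using U(2)[OF \<open>s \<le> t\<close>] by simp
qed

text \<open>The orbit through \<open>w s\<close> is itself a mild solution, by variation of
  constants with zero forcing; its difference from \<open>w\<close> vanishes at \<open>s\<close> and
  hence at \<open>t\<close>.\<close>

lemma homogeneous_mild_solution:
  assumes T: "c0_group T" and G: "infinitesimal_generator D A T"
    and w: "mild_solution D A (\<lambda>t. 0) w" and "s \<le> t"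
  shows "w t = T (t - s) (w s)"
proof -
  have "continuous_on UNIV (\<lambda>t. T (t - s) (w s))"
    by (rule c0_group_continuous_on[OF T]) (auto intro!: continuous_intros)
  then have "mild_solution D A (\<lambda>t. 0) (\<lambda>t. T (t - s) (w s))"
    by (intro mild_solution_variation_of_constants[OF T G])
      (simp_all add: c0_group_add[OF T, symmetric] algebra_simps)
  from mild_solution_diff[OF G _ _ w this]
  have "mild_solution D A (\<lambda>t. 0) (\<lambda>t. w t - T (t - s) (w s))"
    by simp
  from homogeneous_mild_solution_zero[OF T G this _ \<open>s \<le> t\<close>] show ?thesis
    by (simp add: c0_group_zero[OF T])
qed

section \<open>The Green function\<close>

lemma green_translate: "green T P t s = green T P (t - s) 0"
  by (simp add: green_def)

text \<open>The projection acts before the group, so \<open>T h\<close> just advances time in either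
  branch. Only for \<open>s\<close> in \<open>{t<..t + h}\<close> does the branch change, and the
  jump is \<open>P + (I - P) = I\<close>. The interval is half-open because the diagonal belongs to
  the branch with \<open>P\<close>.\<close>

lemma green_step:
  assumes T: "c0_group T" and "h \<ge> 0"
  shows "green T P (t + h) s x - T h (green T P t s x)
    = (if s \<in> {t<..t + h} then T (t + h - s) x else 0)"
proof -
  have "T h (T (t - s) v) = T (t + h - s) v" for v
    by (simp add: c0_group_add[OF T, symmetric] algebra_simps)
  then show ?thesis
    using \<open>h \<ge> 0\<close>
    by (auto simp: green_def blinfun.minus_left blinfun.minus_right blinfun.diff_left blinfun.diff_right)
qed

lemma green_variation_of_constants:
  assumes T: "c0_group T"
    and y: "\<And>t. ((\<lambda>s. green T P t s (f s)) has_integral y t) UNIV" and h: "h \<ge> 0"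
  shows "y (t + h) = T h (y t) + integral {t..t + h} (\<lambda>s. T (t + h - s) (f s))"
proof -
  have "((T h \<circ> (\<lambda>s. green T P t s (f s))) has_integral T h (y t)) UNIV"
    using y by (rule has_integral_linear) (rule blinfun.bounded_linear_right)
  with y have diff: "((\<lambda>s. green T P (t + h) s (f s) - (T h \<circ> (\<lambda>s. green T P t s (f s))) s)
      has_integral y (t + h) - T h (y t)) UNIV"
    by (rule has_integral_diff)
  have "((\<lambda>s. if s \<in> {t<..t + h} then T (t + h - s) (f s) else 0)
      has_integral y (t + h) - T h (y t)) UNIV"
    by (rule has_integral_eq[OF _ diff]) (unfold o_apply, rule green_step[OF T h])
  \<comment> \<open>Closing the interval at \<open>t\<close> alters the integrand at a single
    point.\<close>
  then have "((\<lambda>s. if s \<in> {t..t + h} then T (t + h - s) (f s) else 0) has_integral y (t + h) - T h (y t)) UNIV"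
    by (rule has_integral_spike_finite[of "{t}", rotated 2]) auto
  then have "((\<lambda>s. T (t + h - s) (f s)) has_integral y (t + h) - T h (y t)) {t..t + h}"
    unfolding has_integral_restrict_UNIV .
  then have "integral {t..t + h} (\<lambda>s. T (t + h - s) (f s)) = y (t + h) - T h (y t)"
    by (rule integral_unique)
  then show ?thesis
    by simp
qed

section \<open>Estimates from the exponential dichotomy\<close>

context
  fixes T :: "real \<Rightarrow> 'a::banach \<Rightarrow>\<^sub>L 'a" and P :: "'a \<Rightarrow>\<^sub>L 'a" and c \<alpha> :: real
  assumes T: "c0_group T" and c: "c > 0" and \<alpha>: "\<alpha> > 0"
    and dichotomy: "\<And>t s. norm (green T P t s) \<le> c * exp (- \<alpha> * \<bar>t - s\<bar>)"
begin

lemma norm_green_apply: "norm (green T P t 0 x) \<le> c * exp (- \<alpha> * \<bar>t\<bar>) * norm x"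
  using order_trans[OF norm_blinfun mult_right_mono[OF dichotomy[of t 0] norm_ge_zero]] by simp

text \<open>The kernel jumps at 0 but is strongly continuous on either side. The interval is
  enlarged by \<open>min a 0\<close> and \<open>max b 0\<close> to contain 0, split there, and
  finally cut back.\<close>

lemma green_integrable_interval:
  assumes f: "continuous_on UNIV f"
  shows "(\<lambda>u. green T P u 0 (f (t - u))) integrable_on {a..b}"
proof -
  have cont: "continuous_on S (\<lambda>u. T u (Q (f (t - u))))" for S and Q :: "'a \<Rightarrow>\<^sub>L 'a"
    by (rule c0_group_continuous_on[OF T])
      (auto intro!: continuous_on_compose2[OF f] continuous_intros)
  have "(\<lambda>u. T u (P (f (t - u)))) integrable_on {0..max b 0}"
    by (rule integrable_continuous_real[OF cont])
  then have right: "(\<lambda>u. green T P u 0 (f (t - u))) integrable_on {0..max b 0}"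
    by (rule integrable_eq) (simp add: green_def)
  have "(\<lambda>u. - T u ((id_blinfun - P) (f (t - u)))) integrable_on {min a 0..0}"
    by (rule integrable_neg[OF integrable_continuous_real[OF cont]])
  \<comment> \<open>At \<open>u = 0\<close> the kernel takes the branch with \<open>P\<close>, so
    the left integrand differs from the continuous one at that point.\<close>
  then have left: "(\<lambda>u. green T P u 0 (f (t - u))) integrable_on {min a 0..0}"
    by (rule integrable_spike_finite[of "{0}", rotated 2]) (auto simp: green_def blinfun.minus_left)
  have "(\<lambda>u. green T P u 0 (f (t - u))) integrable_on {min a 0..max b 0}"
    by (rule Henstock_Kurzweil_Integration.integrable_combine[OF _ _ left right]) auto
  then show ?thesis
    by (rule integrable_subinterval_real) auto
qed

text \<open>Domination by \<open>c * exp (- \<alpha> * \<bar>u\<bar>) * B\<close> gives both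
  convergence over the line and the bound.\<close>

lemma green_integrable:
  assumes f: "continuous_on UNIV f" and B: "\<And>t. norm (f t) \<le> B"
  shows "(\<lambda>u. green T P u 0 (f (t - u))) integrable_on UNIV"
    and "norm (integral UNIV (\<lambda>u. green T P u 0 (f (t - u)))) \<le> 2 * c / \<alpha> * B"
proof -
  have int: "((\<lambda>u. c * exp (- \<alpha> * \<bar>u\<bar>) * B) has_integral 2 * c / \<alpha> * B) UNIV"
    by (intro has_integral_mult_left has_integral_exp_abs \<alpha>)
  then have int': "(\<lambda>u. c * exp (- \<alpha> * \<bar>u\<bar>) * B) integrable_on UNIV"
    by blast
  have bound: "norm (green T P u 0 (f (t - u))) \<le> c * exp (- \<alpha> * \<bar>u\<bar>) * B" for u
    using c B by (intro order_trans[OF norm_green_apply] mult_left_mono) auto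
  show *: "(\<lambda>u. green T P u 0 (f (t - u))) integrable_on UNIV"
    by (rule integrable_on_all_intervals_integrable_bound[OF _ bound int'])
      (simp add: green_integrable_interval[OF f])
  have "norm (integral UNIV (\<lambda>u. green T P u 0 (f (t - u)))) \<le> integral UNIV (\<lambda>u. c * exp (- \<alpha> * \<bar>u\<bar>) * B)"
    by (rule integral_norm_bound_integral[OF * int' bound])
  also have "\<dots> = 2 * c / \<alpha> * B"
    by (rule integral_unique[OF int])
  finally show "norm (integral UNIV (\<lambda>u. green T P u 0 (f (t - u)))) \<le> 2 * c / \<alpha> * B" .
qed

text \<open>Since the kernel depends only on \<open>t - s\<close>, the substitution
  \<open>u = t - s\<close> turns the convolution into the integral of the theorem.\<close>

lemma green_has_integral:
  assumes f: "continuous_on UNIV f" and B: "\<And>t. norm (f t) \<le> B"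
  shows "((\<lambda>s. green T P t s (f s)) has_integral
      integral UNIV (\<lambda>u. green T P u 0 (f (t - u)))) UNIV"
proof -
  define g where "g u = green T P u 0 (f (t - u))" for u
  have "g integrable_on UNIV"
    unfolding g_def using f B by (rule green_integrable(1))
  then have "((\<lambda>s. g (t - s)) has_integral integral UNIV g) UNIV"
    by (intro has_integral_reflect_translate integrable_integral)
  moreover have "g (t - s) = green T P t s (f s)" for s
    unfolding g_def green_translate[of T P t s] by simp
  ultimately show ?thesis
    unfolding g_def by simp
qed

lemma green_almost_automorphic:
  assumes f: "f \<in> almost_automorphic"
  shows "(\<lambda>t. integral UNIV (\<lambda>u. green T P u 0 (f (t - u)))) \<in> almost_automorphic"
proof (rule almost_automorphic_convolution[OF f])
  let ?k = "\<lambda>u. c * exp (- \<alpha> * \<bar>u\<bar>)"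
  show k: "continuous_on UNIV ?k"
    by (intro continuous_intros)
  show k_int: "?k integrable_on UNIV"
    using has_integral_exp_abs[OF \<alpha>] by (auto simp: integrable_on_def)
  show k_nonneg: "0 \<le> ?k u" for u
    using c by simp
  have contf: "continuous_on UNIV f"
    using f by (simp add: almost_automorphic_def)
  obtain B where B: "\<And>t. norm (f t) \<le> B"
    using almost_automorphic_bounded[OF f] by blast
  note int = green_integrable(1)[OF contf B]
  show "norm (integral UNIV (\<lambda>u. green T P u 0 (f (a - u))) - integral UNIV (\<lambda>u. green T P u 0 (f (b - u))))
      \<le> integral UNIV (\<lambda>u. ?k u * norm (f (a - u) - f (b - u)))" for a b
    unfolding integral_diff[OF int int, symmetric]
  proof (rule integral_norm_bound_integral)
    show "(\<lambda>u. green T P u 0 (f (a - u)) - green T P u 0 (f (b - u))) integrable_on UNIV"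
      by (intro integrable_diff int)
    show "(\<lambda>u. ?k u * norm (f (a - u) - f (b - u))) integrable_on UNIV"
    proof (rule weighted_integrable[OF k k_int k_nonneg, where C = "2 * B"])
      show "continuous_on UNIV (\<lambda>u. norm (f (a - u) - f (b - u)))"
        by (auto intro!: continuous_on_compose2[OF contf] continuous_intros)
      show "\<bar>norm (f (a - u) - f (b - u))\<bar> \<le> 2 * B" for u
        using norm_triangle_ineq4[of "f (a - u)" "f (b - u)"] B[of "a - u"] B[of "b - u"] by simp
    qed
    show "norm (green T P u 0 (f (a - u)) - green T P u 0 (f (b - u))) \<le> ?k u * norm (f (a - u) - f (b - u))" for u
      using norm_green_apply[of u "f (a - u) - f (b - u)"] by (simp add: blinfun.diff_right)
  qed
qed

text \<open>The component in the range of \<open>P\<close> is computed from the past value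
  \<open>w (t - h)\<close>, the complementary one from the future value \<open>w (t + h)\<close>.
  Commutation turns each into a Green function applied to a bounded vector, with norm at most
  \<open>c * exp (- \<alpha> * h) * B\<close> for every positive \<open>h\<close>.\<close>

lemma bounded_orbit_zero:
  assumes P: "commutes_with_group P T"
    and w: "\<And>s t. s \<le> t \<Longrightarrow> w t = T (t - s) (w s)" and B: "\<And>t. norm (w t) \<le> B"
  shows "w t = 0"
proof -
  have TP: "T t (P x) = P (T t x)" for t x
    using P by (metis blinfun_apply_blinfun_compose commutes_with_group_def)
  have lim: "((\<lambda>h. c * exp (- \<alpha> * h) * B) \<longlongrightarrow> 0) at_top"
  proof -
    have "filterlim (\<lambda>h. - \<alpha> * h) at_bot at_top"
      using \<alpha> by (intro filterlim_tendsto_neg_mult_at_bot[OF tendsto_const] filterlim_ident) auto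
    then have "((\<lambda>h. exp (- \<alpha> * h)) \<longlongrightarrow> 0) at_top"
      by (rule filterlim_compose[OF exp_at_bot])
    then show ?thesis
      by (intro tendsto_mult_left_zero tendsto_mult_right_zero)
  qed
  have small: "x = 0" if "\<And>h. h > 0 \<Longrightarrow> norm x \<le> c * exp (- \<alpha> * h) * B" for x :: 'a
  proof -
    have "norm x \<le> 0"
      by (rule tendsto_lowerbound[OF lim]) (use that in \<open>auto intro: eventually_mono[OF eventually_gt_at_top[of 0]]\<close>)
    then show ?thesis
      by simp
  qed
  have "P (w t) = 0"
  proof (rule small)
    fix h :: real assume h: "h > 0"
    have "P (w t) = green T P h 0 (w (t - h))"
      using h w[of "t - h" t] by (simp add: green_def TP)
    also have "norm \<dots> \<le> c * exp (- \<alpha> * \<bar>h\<bar>) * norm (w (t - h))"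
      by (rule norm_green_apply)
    also have "\<dots> \<le> c * exp (- \<alpha> * h) * B"
      using h c B by (auto intro!: mult_left_mono)
    finally show "norm (P (w t)) \<le> c * exp (- \<alpha> * h) * B" .
  qed
  moreover have "w t - P (w t) = 0"
  proof (rule small)
    fix h :: real assume h: "h > 0"
    have "T (- h) (w (t + h)) = w t"
      using h w[of t "t + h"] by (simp add: c0_group_add[OF T, symmetric] c0_group_zero[OF T])
    \<comment> \<open>Strict positivity of \<open>h\<close> matters: it puts \<open>- h\<close> on
      the branch with \<open>I - P\<close>, whose minus sign disappears under the norm.\<close>
    then have "norm (w t - P (w t)) = norm (green T P (- h) 0 (w (t + h)))"
      using h by (simp add: green_def TP blinfun.minus_left blinfun.diff_left blinfun.diff_right norm_minus_commute)
    also have "\<dots> \<le> c * exp (- \<alpha> * \<bar>- h\<bar>) * norm (w (t + h))"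
      by (rule norm_green_apply)
    also have "\<dots> \<le> c * exp (- \<alpha> * h) * B"
      using h c B by (auto intro!: mult_left_mono)
    finally show "norm (w t - P (w t)) \<le> c * exp (- \<alpha> * h) * B" .
  qed
  ultimately show ?thesis
    by simp
qed

end

theorem theorem3p4:
  fixes T :: "real \<Rightarrow> 'a::banach \<Rightarrow>\<^sub>L 'a"
    and D :: "'a set" and A :: "'a \<Rightarrow> 'a"
    and P :: "'a \<Rightarrow>\<^sub>L 'a"
    and c \<alpha> :: real
    and f :: "real \<Rightarrow> 'a"
  assumes "c0_group T"
    and "infinitesimal_generator D A T"
    and "P o\<^sub>L P = P"
    and "c > 0" and "\<alpha> > 0"
    and "\<And>t s. norm (green T P t s) \<le> c * exp (- \<alpha> * \<bar>t - s\<bar>)"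
    and "f \<in> almost_automorphic"
  shows "\<exists>y\<in>almost_automorphic.
           mild_solution D A f y \<and>
           (commutes_with_group P T \<longrightarrow>
              (\<forall>z\<in>almost_automorphic. mild_solution D A f z \<longrightarrow> z = y)) \<and>
           (\<forall>t. ((\<lambda>s. green T P t s (f s)) has_integral y t) UNIV) \<and>
           sup_norm y \<le> 2 * c / \<alpha> * sup_norm f"
proof -
  note T = assms(1) and G = assms(2)
  note dich = assms(1,4,5,6)
  have f: "continuous_on UNIV f"
    using assms(7) by (simp add: almost_automorphic_def)
  have bdd: "bdd_above (range (\<lambda>t. norm (g t)))" if "g \<in> almost_automorphic" for g :: "real \<Rightarrow> 'a"
    using almost_automorphic_bounded[OF that] by (metis bdd_aboveI2)
  \<comment> \<open>Boundedness of \<open>f\<close> makes the supremum a genuine bound, so the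
    kernel estimate applies with \<open>sup_norm f\<close> itself and gives the constant of the
    theorem.\<close>
  have B: "norm (f t) \<le> sup_norm f" for t
    unfolding sup_norm_def by (rule cSUP_upper[OF UNIV_I bdd[OF assms(7)]])
  define y where "y t = integral UNIV (\<lambda>u. green T P u 0 (f (t - u)))" for t
  have y: "y \<in> almost_automorphic"
    unfolding y_def[abs_def] by (rule green_almost_automorphic[OF dich assms(7)])
  have int: "((\<lambda>s. green T P t s (f s)) has_integral y t) UNIV" for t
    unfolding y_def by (rule green_has_integral[OF dich f B])
  have sol: "mild_solution D A f y"
    using y by (intro mild_solution_variation_of_constants[OF T G f] green_variation_of_constants[OF T int])
      (simp_all add: almost_automorphic_def)
  have "z = y" if P: "commutes_with_group P T" and z: "z \<in> almost_automorphic" "mild_solution D A f z" for z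
  proof
    fix t
    obtain B1 B2 where "\<And>t. norm (z t) \<le> B1" "\<And>t. norm (y t) \<le> B2"
      using almost_automorphic_bounded[OF z(1)] almost_automorphic_bounded[OF y] by metis
    then have bound: "norm (z t - y t) \<le> B1 + B2" for t
      by (meson add_mono norm_triangle_ineq4 order_trans)
    \<comment> \<open>The forcing terms cancel, so the difference is a bounded group orbit, which
      the dichotomy forces to vanish.\<close>
    have "mild_solution D A (\<lambda>t. 0) (\<lambda>t. z t - y t)"
      using mild_solution_diff[OF G f f z(2) sol] by simp
    from bounded_orbit_zero[OF dich P homogeneous_mild_solution[OF T G this] bound]
    show "z t = y t"
      by simp
  qed
  moreover have "sup_norm y \<le> 2 * c / \<alpha> * sup_norm f"
    unfolding sup_norm_def[of y] y_def by (intro cSUP_least green_integrable(2)[OF dich f B]) simp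
  ultimately show ?thesis
    using y sol int by blast
qed

end
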